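(* Let $s,t\ge 0$. Let $A$ be a set of points on the $x$-axis such that $0<\mathsf{H}^s(A)<+\infty$ and let $B$ be a set of points on the $y$-axis such that $0<\mathsf{H}^t(B)<+\infty$. Suppose that $$\dim_{MB}(A\times B)\ge\dim_{MB}A+\dim_{MB}B$$ and that, for all $y\in B$, $d^t(y)>0$, where $d^t(y)=\liminf_{h\to0}\dfrac{\mathsf{H}^t(B\cap B(y,h))}{(2h)^t}$ is the lower $t$-dimensional density of the set $B$ at $y$. Then $$\dim_{MB}(A\times B)=\dim_{MB}(A)+\dim_{MB}(B).$$
   Context: $\mathbb{R}^n$ carries the Euclidean distance; $B(x,r)$ is the closed ball of centre $x$ and radius $r$. For $E\subset\mathbb{R}^n$ and $r>0$, $N_r(E)$ is the infimum of the numbers of elements of families of closed balls $(B(x_i,r))_{i\in I}$ with $x_i\in E$ and $E\subseteq\bigcup_iB(x_i,r)$. For $t\ge 0$, $\overline{\mathsf{H}}^t_r(E)=N_r(E)(2r)^t$, $\overline{\mathsf{H}}^t(E)=\liminf_{r\to0}\overline{\mathsf{H}}^t_r(E)$, and the Hewitt-Stromberg measure is $$\mathsf{H}^t(E)=\inf\Big\{\sum_i\overline{\mathsf{H}}^t(E_i) : E\subseteq\bigcup_iE_i\Big\},$$ over countable covers. The Hewitt-Stromberg dimension is $\dim_{MB}E=\sup\{t\ge0:\mathsf{H}^t(E)=+\infty\}=\inf\{t\ge0:\mathsf{H}^t(E)=0\}$. The sets $A$ and $B$ are identified with subsets of $\mathbb{R}$, and $A\times B\subset\mathbb{R}^2$.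 *)

theory Defs
  imports "HOL-Analysis.Analysis"
begin

text \<open>
  A family of closed balls of radius \<open>r\<close> is represented by the set of its centres (repetitions
  never lower the number of balls). Only finite families are listed: if there is no finite one,
  the infimum of the empty set in \<^typ>\<open>ennreal\<close> is \<open>\<infinity>\<close>.
\<close>

definition covering_number :: "real \<Rightarrow> 'a::euclidean_space set \<Rightarrow> ennreal" where
  "covering_number r E =
     (INF X \<in> {X. finite X \<and> X \<subseteq> E \<and> E \<subseteq> (\<Union>x\<in>X. cball x r)}. of_nat (card X))"

definition hs_pre_at :: "real \<Rightarrow> real \<Rightarrow> 'a::euclidean_space set \<Rightarrow> ennreal" where
  "hs_pre_at t r E = covering_number r E * ennreal ((2 * r) powr t)"

definition hs_pre :: "real \<Rightarrow> 'a::euclidean_space set \<Rightarrow> ennreal" where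
  "hs_pre t E = Liminf (at_right 0) (\<lambda>r. hs_pre_at t r E)"

text \<open>
  Countable covers are sequences of sets; finite covers are included, because
  \<open>hs_pre t {} = 0\<close> allows padding with empty sets.
\<close>

definition hs_measure :: "real \<Rightarrow> 'a::euclidean_space set \<Rightarrow> ennreal" where
  "hs_measure t E = (INF F \<in> {F :: nat \<Rightarrow> 'a set. E \<subseteq> (\<Union>i. F i)}. \<Sum>i. hs_pre t (F i))"

text \<open>
  The supremum is taken in \<^typ>\<open>ennreal\<close>, so it is \<open>0\<close> when no \<open>t\<close> qualifies. The lemma
  \<open>hs_dim_eq_INF\<close> below gives the description as an infimum.
\<close>

definition hs_dim :: "'a::euclidean_space set \<Rightarrow> ennreal" where
  "hs_dim E = (SUP t \<in> {t::real. t \<ge> 0 \<and> hs_measure t E = \<infinity>}. ennreal t)"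

definition hs_lower_density :: "real \<Rightarrow> 'a::euclidean_space set \<Rightarrow> 'a \<Rightarrow> ennreal" where
  "hs_lower_density t E x =
     Liminf (at_right 0) (\<lambda>h. hs_measure t (E \<inter> cball x h) / ennreal ((2 * h) powr t))"

lemma hs_pre_empty: "hs_pre t {} = 0"
proof -
  have "covering_number r ({} :: 'a set) = 0" for r
    unfolding covering_number_def by (simp add: Collect_conv_if)
  then show ?thesis
    by (simp add: hs_pre_def hs_pre_at_def Liminf_const)
qed

lemma hs_pre_eq_0:
  assumes "hs_pre t E < \<infinity>" "t < u"
  shows "hs_pre u E = 0"
proof -
  obtain C where C: "hs_pre t E < ennreal C" "C > 0"
  proof -
    obtain c where "hs_pre t E = ennreal c" "c \<ge> 0"
      using assms(1) by (cases "hs_pre t E") auto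
    then show ?thesis
      using that[of "c + 1"] by (simp add: ennreal_less_iff)
  qed
  have freq: "\<exists>\<^sub>F r in at_right 0. hs_pre_at t r E < ennreal C"
  proof (rule ccontr)
    assume "\<not> ?thesis"
    then have "\<forall>\<^sub>F r in at_right 0. ennreal C \<le> hs_pre_at t r E"
      by (simp add: not_frequently not_less)
    then have "ennreal C \<le> hs_pre t E"
      unfolding hs_pre_def by (rule Liminf_bounded)
    with C show False by simp
  qed
  have "hs_pre u E \<le> ennreal e" if e: "e > 0" for e :: real
  proof -
    have "((\<lambda>r::real. C * (2 * r) powr (u - t)) \<longlongrightarrow> C * (2 * 0) powr (u - t)) (at_right 0)"
      using assms(2)
      by (intro tendsto_intros tendsto_powr') (auto simp: eventually_at_filter)
    then have "\<forall>\<^sub>F r in at_right 0. C * (2 * r) powr (u - t) < e"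
      using e by (auto dest: order_tendstoD(2))
    moreover have "\<forall>\<^sub>F r::real in at_right 0. r > 0"
      by (simp add: eventually_at_right_less)
    ultimately have "\<forall>\<^sub>F r in at_right 0. r > 0 \<and> C * (2 * r) powr (u - t) < e"
      by (rule eventually_elim2) simp
    then have "\<exists>\<^sub>F r in at_right 0.
        hs_pre_at t r E < ennreal C \<and> r > 0 \<and> C * (2 * r) powr (u - t) < e"
      by (rule frequently_eventually_conj[OF freq, THEN frequently_elim1]) auto
    then have *: "\<exists>\<^sub>F r in at_right 0. hs_pre_at u r E \<le> ennreal e"
    proof (rule frequently_elim1)
      fix r assume r: "hs_pre_at t r E < ennreal C \<and> r > 0 \<and> C * (2 * r) powr (u - t) < e"
      have "hs_pre_at u r E = hs_pre_at t r E * ennreal ((2 * r) powr (u - t))"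
        using r by (simp add: hs_pre_at_def mult.assoc flip: ennreal_mult' powr_add)
      also have "\<dots> \<le> ennreal C * ennreal ((2 * r) powr (u - t))"
        using r by (intro mult_right_mono) auto
      also have "\<dots> \<le> ennreal e"
        using r C by (simp add: ennreal_leI flip: ennreal_mult')
      finally show "hs_pre_at u r E \<le> ennreal e" .
    qed
    show ?thesis
    proof (rule ccontr)
      assume "\<not> ?thesis"
      then have "ennreal e < hs_pre u E" by simp
      then have "\<forall>\<^sub>F r in at_right 0. ennreal e < hs_pre_at u r E"
        unfolding hs_pre_def by (rule less_LiminfD)
      with * show False
        by (simp add: frequently_def not_le)
    qed
  qed
  then show ?thesis
    by (metis ennreal_le_epsilon add_0 le_zero_eq)
qed

lemma hs_measure_eq_0:
  assumes "hs_measure t E < \<infinity>" "t < u"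
  shows "hs_measure u E = 0"
proof -
  obtain F :: "nat \<Rightarrow> 'a set" where F: "E \<subseteq> (\<Union>i. F i)" "(\<Sum>i. hs_pre t (F i)) < \<infinity>"
    using assms(1) unfolding hs_measure_def INF_less_iff by auto
  have "hs_pre t (F i) < \<infinity>" for i
    using F(2) ennreal_suminf_lessD by simp
  then have "hs_pre u (F i) = 0" for i
    using assms(2) hs_pre_eq_0 by blast
  then have "hs_measure u E \<le> 0"
    unfolding hs_measure_def using F(1) by (intro INF_lower2[of F]) auto
  then show ?thesis by simp
qed

lemma hs_dim_eq_INF:
  "hs_dim E = (INF t \<in> {t::real. t \<ge> 0 \<and> hs_measure t E = 0}. ennreal t)"
proof (rule antisym)
  show "hs_dim E \<le> (INF t \<in> {t::real. t \<ge> 0 \<and> hs_measure t E = 0}. ennreal t)"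
    unfolding hs_dim_def
  proof (intro SUP_least INF_greatest)
    fix a b :: real
    assume "a \<in> {t. t \<ge> 0 \<and> hs_measure t E = \<infinity>}" "b \<in> {t. t \<ge> 0 \<and> hs_measure t E = 0}"
    then have "\<not> b < a"
      using hs_measure_eq_0[of b E a] by auto
    then show "ennreal a \<le> ennreal b" by (simp add: ennreal_leI)
  qed
  show "(INF t \<in> {t::real. t \<ge> 0 \<and> hs_measure t E = 0}. ennreal t) \<le> hs_dim E" (is "?I \<le> _")
  proof (rule ccontr)
    assume "\<not> ?thesis"
    then have "hs_dim E < ?I" by simp
    then obtain c where c: "hs_dim E < c" "c < ?I" using dense by blast
    then obtain d where d: "c < d" "d < ?I" using dense by blast
    obtain a where a: "c = ennreal a" "a \<ge> 0"
      using d by (cases c) auto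
    obtain b where b: "d = ennreal b" "b \<ge> 0"
      using d by (cases d) auto
    have "hs_measure a E \<noteq> \<infinity>"
    proof
      assume "hs_measure a E = \<infinity>"
      then have "c \<le> hs_dim E"
        unfolding hs_dim_def a(1) using a(2) by (intro SUP_upper) auto
      with c show False by simp
    qed
    moreover have "a < b"
      using d a b by (simp add: ennreal_less_iff)
    ultimately have "hs_measure b E = 0"
      using hs_measure_eq_0[of a E b] by (simp add: less_top)
    then have "?I \<le> d"
      unfolding b(1) using b(2) by (intro INF_lower) auto
    with d show False by simp
  qed
qed

end

(*
  Up to the factor 2^t, H^t is superadditive on finite families of sets at positive distance from
  each other. Where the lower density of B is bounded below at all scales h < 1/(k+1), a
  2h-separated set therefore has at most O(h^-t) points, so that this part G_k of B satisfies
  N_r(G_k) = O(r^-t) for all small r. Since N_2r(F x G_k) <= N_r(F) N_r(G_k), the lower limit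
  defining the premeasure of F x G_k in dimension s + t is finite as soon as that of F in
  dimension s is. Countably many such products cover A x B, hence dim (A x B) <= s + t.
*)

theory Submission
  imports Defs
begin

section \<open>Lower limits of functions with values in \<open>ennreal\<close>\<close>

text \<open>Transferred from the extended reals: \<open>enn2ereal\<close> is continuous and
  monotone, so it commutes with \<open>Liminf\<close>.\<close>

lemma Liminf_add_le_ennreal:
  fixes f g :: "'a \<Rightarrow> ennreal"
  assumes F: "F \<noteq> bot"
  shows "Liminf F f + Liminf F g \<le> Liminf F (\<lambda>x. f x + g x)"
proof -
  have "Liminf F (\<lambda>x. enn2ereal (h x)) = enn2ereal (Liminf F h)" for h :: "'a \<Rightarrow> ennreal"
    by (rule Liminf_compose_continuous_mono) (auto simp: mono_def less_eq_ennreal.rep_eq F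
        intro!: continuous_on_enn2ereal)
  moreover have "Liminf F (\<lambda>x. enn2ereal (f x)) + Liminf F (\<lambda>x. enn2ereal (g x))
      \<le> Liminf F (\<lambda>x. enn2ereal (f x) + enn2ereal (g x))"
    by (rule Liminf_add_le) (auto simp: F)
  ultimately show ?thesis
    by (simp add: less_eq_ennreal.rep_eq plus_ennreal.rep_eq flip: plus_ennreal.rep_eq)
qed

lemma sum_Liminf_le_ennreal:
  fixes f :: "'i \<Rightarrow> 'a \<Rightarrow> ennreal"
  assumes "F \<noteq> bot"
  shows "(\<Sum>i\<in>I. Liminf F (f i)) \<le> Liminf F (\<lambda>x. \<Sum>i\<in>I. f i x)"
proof (induction I rule: infinite_finite_induct)
  case (insert i I)
  then have "(\<Sum>i\<in>insert i I. Liminf F (f i)) \<le> Liminf F (f i) + Liminf F (\<lambda>x. \<Sum>i\<in>I. f i x)"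
    by (auto intro: add_left_mono)
  also have "\<dots> \<le> Liminf F (\<lambda>x. f i x + (\<Sum>i\<in>I. f i x))"
    by (rule Liminf_add_le_ennreal[OF assms])
  finally show ?case
    using insert by simp
qed auto

lemma Liminf_cmult_ennreal:
  fixes f :: "'a \<Rightarrow> ennreal"
  assumes "F \<noteq> bot" "c < \<infinity>"
  shows "Liminf F (\<lambda>x. c * f x) = c * Liminf F f"
  using assms by (intro Liminf_compose_continuous_mono monoI mult_left_mono
      ennreal_continuous_on_cmult continuous_on_id) auto

text \<open>The covering estimates below compare radius \<open>2 * r\<close> with radius
  \<open>r\<close>; this absorbs the doubling in the limit.\<close>

lemma Liminf_at_right_0_scale:
  fixes f :: "real \<Rightarrow> 'b::complete_linorder"
  assumes "c > 0"
  shows "Liminf (at_right 0) (\<lambda>r. f (c * r)) = Liminf (at_right 0) f"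
proof -
  have "Liminf (at_right 0) f = Liminf (filtermap ((*) c) (at_right 0)) f"
    using filtermap_times_pos_at_right[of c 0] assms by simp
  also have "\<dots> = Liminf (at_right 0) (\<lambda>r. f (c * r))"
    using assms by (intro Liminf_filtermap_eq) (auto simp: inj_on_def)
  finally show ?thesis ..
qed

section \<open>Covering numbers of products and of separated pieces\<close>

lemma covering_number_le:
  assumes "finite X" "X \<subseteq> E" "E \<subseteq> (\<Union>x\<in>X. cball x r)"
  shows "covering_number r E \<le> of_nat (card X)"
  unfolding covering_number_def by (rule INF_lower) (use assms in auto)

text \<open>A finite infimum of cardinalities is a minimum, since the natural numbers are well
  ordered.\<close>

lemma covering_number_attained:
  assumes "covering_number r E < \<infinity>"
  obtains X where "finite X" "X \<subseteq> E" "E \<subseteq> (\<Union>x\<in>X. cball x r)"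
    "covering_number r E = of_nat (card X)"
proof -
  let ?P = "\<lambda>X. finite X \<and> X \<subseteq> E \<and> E \<subseteq> (\<Union>x\<in>X. cball x r)"
  obtain X0 where "?P X0"
    using assms unfolding covering_number_def INF_less_iff by auto
  then obtain X where X: "?P X" "\<And>Y. ?P Y \<Longrightarrow> card X \<le> card Y"
    using ex_has_least_nat[of ?P X0 card] by metis
  then have "of_nat (card X) \<le> covering_number r E"
    unfolding covering_number_def by (intro INF_greatest) auto
  moreover have "covering_number r E \<le> of_nat (card X)"
    using X by (intro covering_number_le) auto
  ultimately show ?thesis
    using that X by (metis antisym)
qed

text \<open>The products of centres serve as centres: the Euclidean distance in the product is at
  most the sum of the two coordinate distances, hence at most \<open>2 * r\<close>.\<close>

lemma covering_number_Times_le: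
  fixes A :: "'a::euclidean_space set" and B :: "'b::euclidean_space set"
  shows "covering_number (2 * r) (A \<times> B) \<le> covering_number r A * covering_number r B"
proof (cases "A = {} \<or> B = {}")
  case True
  then show ?thesis
    using covering_number_le[of "{}" "A \<times> B" "2 * r"] by auto
next
  case False
  \<comment> \<open>In \<open>ennreal\<close>, zero times infinity is zero. If one factor is
    infinite, the bound is trivial only because the other one is nonzero.\<close>
  have nonzero: "covering_number r E \<noteq> 0" if "E \<noteq> {}" for E :: "'c::euclidean_space set"
  proof
    assume *: "covering_number r E = 0"
    then obtain X where "finite X" "E \<subseteq> (\<Union>x\<in>X. cball x r)" "card X = 0"
      using covering_number_attained[of r E] by (metis ennreal_zero_less_top infinity_ennreal_def of_nat_eq_0_iff)
    with that show False by auto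
  qed
  show ?thesis
  proof (cases "covering_number r A < \<infinity> \<and> covering_number r B < \<infinity>")
    case True
    obtain X where X: "finite X" "X \<subseteq> A" "A \<subseteq> (\<Union>x\<in>X. cball x r)"
      "covering_number r A = of_nat (card X)"
      using True covering_number_attained by blast
    obtain Y where Y: "finite Y" "Y \<subseteq> B" "B \<subseteq> (\<Union>x\<in>Y. cball x r)"
      "covering_number r B = of_nat (card Y)"
      using True covering_number_attained by blast
    have "covering_number (2 * r) (A \<times> B) \<le> of_nat (card (X \<times> Y))"
    proof (rule covering_number_le)
      show "A \<times> B \<subseteq> (\<Union>p\<in>X \<times> Y. cball p (2 * r))"
      proof
        fix p assume "p \<in> A \<times> B"
        then obtain x y where xy: "x \<in> X" "y \<in> Y" "dist x (fst p) \<le> r" "dist y (snd p) \<le> r"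
          using X(3) Y(3) by (cases p) (fastforce simp: subset_iff)
        have "dist (x, y) p \<le> dist x (fst p) + dist y (snd p)"
          unfolding dist_prod_def by (simp add: sqrt_sum_squares_le_sum)
        with xy show "p \<in> (\<Union>p\<in>X \<times> Y. cball p (2 * r))"
          by (intro UN_I[of "(x, y)"]) auto
      qed
    qed (use X Y in auto)
    then show ?thesis
      using X Y by (simp add: card_cartesian_product)
  next
    case inf: False
    then have "covering_number r A = \<infinity> \<or> covering_number r B = \<infinity>"
      using less_top infinity_ennreal_def by metis
    then have "covering_number r A * covering_number r B = \<infinity>"
      using False nonzero[of A] nonzero[of B] by (auto simp: ennreal_mult_eq_top_iff)
    then show ?thesis by simp
  qed
qed

text \<open>
  Since centres must lie in the covered set, \<^const>\<open>covering_number\<close> is not monotone;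
  moving the centres into a subset costs a doubling of the radius.
\<close>

lemma sum_covering_number_separated_le:
  assumes "finite I"
    and sep: "\<And>i j x y. \<lbrakk>i \<in> I; j \<in> I; i \<noteq> j; x \<in> E i; y \<in> E j\<rbrakk> \<Longrightarrow> 2 * r < dist x y"
  shows "(\<Sum>i\<in>I. covering_number (2 * r) (F \<inter> E i)) \<le> covering_number r F"
  unfolding covering_number_def[of r F]
proof (rule INF_greatest, clarify)
  fix X assume X: "finite X" "X \<subseteq> F" "F \<subseteq> (\<Union>x\<in>X. cball x r)"
  define Z where "Z i = {x \<in> X. cball x r \<inter> F \<inter> E i \<noteq> {}}" for i
  have "covering_number (2 * r) (F \<inter> E i) \<le> of_nat (card (Z i))" for i
  proof -
    define p where "p x = (SOME y. y \<in> cball x r \<inter> F \<inter> E i)" for x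
    have p: "p x \<in> cball x r \<inter> F \<inter> E i" if "x \<in> Z i" for x
    proof -
      have "\<exists>y. y \<in> cball x r \<inter> F \<inter> E i"
        using that by (auto simp: Z_def)
      then show ?thesis
        unfolding p_def by (rule someI_ex)
    qed
    have "covering_number (2 * r) (F \<inter> E i) \<le> of_nat (card (p ` Z i))"
    proof (rule covering_number_le)
      show "F \<inter> E i \<subseteq> (\<Union>x\<in>p ` Z i. cball x (2 * r))"
      proof
        fix y assume y: "y \<in> F \<inter> E i"
        then obtain x where x: "x \<in> X" "dist x y \<le> r"
          using X(3) by fastforce
        with y have "x \<in> Z i" by (auto simp: Z_def)
        moreover have "dist (p x) y \<le> 2 * r"
          using p[OF \<open>x \<in> Z i\<close>] x(2) dist_triangle[of "p x" y x] by (simp add: dist_commute)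
        ultimately show "y \<in> (\<Union>x\<in>p ` Z i. cball x (2 * r))" by auto
      qed
      show "finite (p ` Z i)" using X(1) by (simp add: Z_def)
      show "p ` Z i \<subseteq> F \<inter> E i" using p by auto
    qed
    also have "\<dots> \<le> of_nat (card (Z i))"
      using X(1) by (auto intro!: card_image_le simp: Z_def)
    finally show ?thesis .
  qed
  then have "(\<Sum>i\<in>I. covering_number (2 * r) (F \<inter> E i)) \<le> (\<Sum>i\<in>I. of_nat (card (Z i)))"
    by (rule sum_mono)
  also have "\<dots> = of_nat (card (\<Union>i\<in>I. Z i))"
  proof -
    \<comment> \<open>Two points of one ball of radius \<open>r\<close> are at distance at most
      \<open>2 * r\<close>, so a ball meets at most one of the pieces and is counted once.\<close>
    have "Z i \<inter> Z j = {}" if ij: "i \<in> I" "j \<in> I" "i \<noteq> j" for i j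
    proof (rule ccontr)
      assume "Z i \<inter> Z j \<noteq> {}"
      then obtain x y z where "y \<in> E i" "z \<in> E j" "dist x y \<le> r" "dist x z \<le> r"
        by (auto simp: Z_def)
      then show False
        using sep[OF ij, of y z] dist_triangle[of y z x] by (simp add: dist_commute)
    qed
    then have "card (\<Union>i\<in>I. Z i) = (\<Sum>i\<in>I. card (Z i))"
      using \<open>finite I\<close> X(1) by (intro card_UN_disjoint) (auto simp: Z_def)
    then show ?thesis by simp
  qed
  also have "\<dots> \<le> of_nat (card X)"
    using X(1) by (auto intro!: card_mono simp: Z_def)
  finally show "(\<Sum>i\<in>I. covering_number (2 * r) (F \<inter> E i)) \<le> of_nat (card X)" .
qed

section \<open>Superadditivity on separated families, up to a factor\<close>

text \<open>For \<open>r < \<delta> / 2\<close> the bound on covering numbers applies at each scale,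
  and a sum of lower limits is at most the lower limit of the sum. The factor
  \<open>2 powr t\<close> is the price of the doubled radius.\<close>

lemma sum_hs_pre_separated_le:
  assumes "finite I" "\<delta> > 0"
    and sep: "\<And>i j x y. \<lbrakk>i \<in> I; j \<in> I; i \<noteq> j; x \<in> E i; y \<in> E j\<rbrakk> \<Longrightarrow> \<delta> \<le> dist x y"
  shows "(\<Sum>i\<in>I. hs_pre t (F \<inter> E i)) \<le> ennreal (2 powr t) * hs_pre t F"
proof -
  have "(\<Sum>i\<in>I. hs_pre t (F \<inter> E i))
      = (\<Sum>i\<in>I. Liminf (at_right 0) (\<lambda>r. hs_pre_at t (2 * r) (F \<inter> E i)))"
    unfolding hs_pre_def by (subst Liminf_at_right_0_scale) auto
  also have "\<dots> \<le> Liminf (at_right 0) (\<lambda>r. \<Sum>i\<in>I. hs_pre_at t (2 * r) (F \<inter> E i))"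
    by (rule sum_Liminf_le_ennreal) simp
  also have "\<dots> \<le> Liminf (at_right 0) (\<lambda>r. ennreal (2 powr t) * hs_pre_at t r F)"
  proof (rule Liminf_mono)
    have "\<forall>\<^sub>F r in at_right 0. r \<in> {0<..<\<delta> / 2}"
      using \<open>\<delta> > 0\<close> by (intro eventually_at_rightI[of 0 "\<delta> / 2"]) auto
    then show "\<forall>\<^sub>F r in at_right 0. (\<Sum>i\<in>I. hs_pre_at t (2 * r) (F \<inter> E i))
        \<le> ennreal (2 powr t) * hs_pre_at t r F"
    proof eventually_elim
      case (elim r)
      then have "(\<Sum>i\<in>I. covering_number (2 * r) (F \<inter> E i)) \<le> covering_number r F"
        using sep by (intro sum_covering_number_separated_le \<open>finite I\<close>) force
      moreover have "ennreal ((2 * (2 * r)) powr t) = ennreal (2 powr t) * ennreal ((2 * r) powr t)"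
        using elim powr_mult[of 2 "2 * r" t] by (simp flip: ennreal_mult')
      ultimately show ?case
        unfolding hs_pre_at_def sum_distrib_right[symmetric]
        by (metis ab_semigroup_mult_class.mult_ac(1) mult.commute mult_right_mono zero_le)
    qed
  qed
  also have "\<dots> = ennreal (2 powr t) * hs_pre t F"
    unfolding hs_pre_def by (rule Liminf_cmult_ennreal) auto
  finally show ?thesis .
qed

text \<open>An almost optimal cover of \<open>B\<close> is cut down to each \<open>E i\<close>.
  After exchanging the two sums, the premeasure bound applies to each member of the cover.\<close>

lemma sum_hs_measure_separated_le:
  assumes "finite I" "\<delta> > 0"
    and sep: "\<And>i j x y. \<lbrakk>i \<in> I; j \<in> I; i \<noteq> j; x \<in> E i; y \<in> E j\<rbrakk> \<Longrightarrow> \<delta> \<le> dist x y"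
    and sub: "\<And>i. i \<in> I \<Longrightarrow> E i \<subseteq> B"
  shows "(\<Sum>i\<in>I. hs_measure t (E i)) \<le> ennreal (2 powr t) * hs_measure t B"
proof (rule ennreal_le_epsilon)
  fix e :: real assume "e > 0"
  \<comment> \<open>Multiplication by \<open>2 powr t\<close> at the end turns this slack into
    \<open>e\<close>.\<close>
  define e' where "e' = e / 2 powr t"
  have "e' > 0" using \<open>e > 0\<close> by (simp add: e'_def)
  assume "ennreal (2 powr t) * hs_measure t B < top"
  then have "hs_measure t B < top"
    by (auto simp: ennreal_mult_less_top)
  \<comment> \<open>Strict only because the measure is finite; strictness is what yields the cover
    \<open>F\<close> from the infimum.\<close>
  then have "hs_measure t B < hs_measure t B + ennreal e'"
    using \<open>e' > 0\<close> by (simp add: ennreal_add_left_cancel_less)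
  then obtain F :: "nat \<Rightarrow> 'b set" where F: "B \<subseteq> (\<Union>j. F j)"
      "(\<Sum>j. hs_pre t (F j)) < hs_measure t B + ennreal e'"
    unfolding hs_measure_def INF_less_iff by auto
  have "hs_measure t (E i) \<le> (\<Sum>j. hs_pre t (F j \<inter> E i))" if "i \<in> I" for i
    unfolding hs_measure_def by (rule INF_lower) (use F(1) sub[OF that] in auto)
  then have "(\<Sum>i\<in>I. hs_measure t (E i)) \<le> (\<Sum>i\<in>I. \<Sum>j. hs_pre t (F j \<inter> E i))"
    by (rule sum_mono)
  also have "\<dots> = (\<Sum>j. \<Sum>i\<in>I. hs_pre t (F j \<inter> E i))"
    by (rule suminf_sum[symmetric]) simp
  also have "\<dots> \<le> (\<Sum>j. ennreal (2 powr t) * hs_pre t (F j))"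
    using assms(1-3) by (intro suminf_le sum_hs_pre_separated_le) auto
  also have "\<dots> = ennreal (2 powr t) * (\<Sum>j. hs_pre t (F j))"
    by simp
  also have "\<dots> \<le> ennreal (2 powr t) * (hs_measure t B + ennreal e')"
    using F(2) by (intro mult_left_mono) auto
  also have "\<dots> = ennreal (2 powr t) * hs_measure t B + ennreal e"
    using \<open>e > 0\<close> by (simp add: distrib_left e'_def flip: ennreal_mult')
  finally show "(\<Sum>i\<in>I. hs_measure t (E i)) \<le> ennreal (2 powr t) * hs_measure t B + ennreal e" .
qed

section \<open>Packing bounds\<close>

text \<open>The balls of radius \<open>h\<close> about the points of \<open>S\<close> have positive
  mutual gaps, and a finite \<open>S\<close> gives one gap for all pairs. Each ball carries measure
  at least \<open>b\<close>, so superadditivity limits their number.\<close>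

lemma card_separated_mult_le:
  assumes S: "finite S" and sep: "pairwise (\<lambda>x y. 2 * h < dist x y) S"
    and b: "\<And>y. y \<in> S \<Longrightarrow> ennreal b \<le> hs_measure t (B \<inter> cball y h)" "b \<ge> 0"
    and m: "hs_measure t B = ennreal m" "m \<ge> 0"
  shows "real (card S) * b \<le> 2 powr t * m"
proof -
  obtain \<delta> where \<delta>: "\<delta> > 0" "\<And>x y. \<lbrakk>x \<in> S; y \<in> S; x \<noteq> y\<rbrakk> \<Longrightarrow> \<delta> \<le> dist x y - 2 * h"
  proof
    \<comment> \<open>The element 1 keeps the set nonempty when \<open>S\<close> has at most one
      point, so that \<open>Min\<close> is meaningful.\<close>
    let ?D = "insert 1 ((\<lambda>(x, y). dist x y - 2 * h) ` (S \<times> S - Id))"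
    have fin: "finite ?D" using S by auto
    have "0 < e" if "e \<in> ?D" for e
      using that
    proof
      assume "e \<in> (\<lambda>(x, y). dist x y - 2 * h) ` (S \<times> S - Id)"
      then obtain x y where "e = dist x y - 2 * h" "x \<in> S" "y \<in> S" "x \<noteq> y"
        by auto
      then show ?thesis
        using pairwiseD[OF sep, of x y] by simp
    qed simp
    with fin show "Min ?D > 0"
      by (subst Min_gr_iff) simp_all
    show "Min ?D \<le> dist x y - 2 * h" if "x \<in> S" "y \<in> S" "x \<noteq> y" for x y
      using that fin by (intro Min_le) auto
  qed
  have "ennreal (real (card S) * b) = (\<Sum>y\<in>S. ennreal b)"
    using b(2) by (simp add: ennreal_mult' ennreal_of_nat_eq_real_of_nat)
  also have "\<dots> \<le> (\<Sum>y\<in>S. hs_measure t (B \<inter> cball y h))"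
    using b(1) by (rule sum_mono)
  also have "\<dots> \<le> ennreal (2 powr t) * hs_measure t B"
  proof (rule sum_hs_measure_separated_le[OF S \<delta>(1)])
    fix i j x y assume *: "i \<in> S" "j \<in> S" "i \<noteq> j" "x \<in> B \<inter> cball i h" "y \<in> B \<inter> cball j h"
    have "dist i j \<le> dist i x + dist x y + dist j y"
      using dist_triangle[of i j x] dist_triangle[of x j y] by (simp add: dist_commute)
    then show "\<delta> \<le> dist x y"
      using \<delta>(2)[OF *(1-3)] *(4,5) by auto
  qed auto
  finally show ?thesis
    using m by (simp flip: ennreal_mult')
qed

text \<open>A \<open>d\<close>-separated subset of maximal cardinality is a set of centres: a point
  missed by its balls could be added to it.\<close>

lemma covering_number_le_packing:
  assumes "d \<ge> 0"
    and M: "\<And>S. \<lbrakk>finite S; S \<subseteq> E; pairwise (\<lambda>x y. d < dist x y) S\<rbrakk> \<Longrightarrow> real (card S) \<le> M"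
  shows "covering_number d E \<le> ennreal M"
proof -
  let ?P = "\<lambda>S. finite S \<and> S \<subseteq> E \<and> pairwise (\<lambda>x y. d < dist x y) S"
  \<comment> \<open>The existence of a maximum is derived from a strict natural bound, hence the
    ceiling and the \<open>Suc\<close>.\<close>
  have bound: "\<forall>S. ?P S \<longrightarrow> card S < Suc (nat \<lceil>M\<rceil>)"
  proof (intro allI impI)
    fix S assume "?P S"
    then have "real (card S) \<le> M" using M by simp
    then show "card S < Suc (nat \<lceil>M\<rceil>)" by linarith
  qed
  have "?P {}" by simp
  note max = arg_max_nat_lemma[of ?P, OF this bound]
  obtain S where S: "?P S" "\<forall>T. ?P T \<longrightarrow> card T \<le> card S"
    by (rule that[OF max[THEN conjunct1] max[THEN conjunct2]])
  have "E \<subseteq> (\<Union>x\<in>S. cball x d)"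
  proof
    fix y assume y: "y \<in> E"
    show "y \<in> (\<Union>x\<in>S. cball x d)"
    proof (rule ccontr)
      assume *: "y \<notin> (\<Union>x\<in>S. cball x d)"
      then have "y \<notin> S"
        using \<open>d \<ge> 0\<close> by auto
      have "?P (insert y S)"
        using S(1) y * by (auto simp: pairwise_insert dist_commute)
      from S(2)[rule_format, OF this] show False
        using \<open>y \<notin> S\<close> S(1) by simp
    qed
  qed
  then have "covering_number d E \<le> of_nat (card S)"
    using S(1) by (intro covering_number_le) auto
  also have "\<dots> \<le> ennreal M"
    using M S(1) by (metis ennreal_leI ennreal_of_nat_eq_real_of_nat)
  finally show ?thesis .
qed

section \<open>Premeasure of a product\<close>

text \<open>The radii that make \<open>hs_pre_at s r A\<close> small may be sparse. A bound for
  \<open>B\<close> at all small radii ensures that both factors are controlled at those same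
  radii.\<close>

lemma hs_pre_Times_finite:
  fixes A :: "'a::euclidean_space set" and B :: "'b::euclidean_space set"
  assumes A: "hs_pre s A < \<infinity>" and K: "K < \<infinity>"
    and B: "\<forall>\<^sub>F r in at_right 0. hs_pre_at t r B \<le> K"
  shows "hs_pre (s + t) (A \<times> B) < \<infinity>"
proof -
  \<comment> \<open>The power of 2 comes from measuring the product at radius \<open>2 * r\<close>
    and the factors at radius \<open>r\<close>.\<close>
  let ?C = "ennreal (2 powr (s + t)) * K"
  have C: "?C < \<infinity>"
    using K by (simp add: ennreal_mult_less_top)
  have "hs_pre (s + t) (A \<times> B) = Liminf (at_right 0) (\<lambda>r. hs_pre_at (s + t) (2 * r) (A \<times> B))"
    unfolding hs_pre_def by (subst Liminf_at_right_0_scale) auto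
  also have "\<dots> \<le> Liminf (at_right 0) (\<lambda>r. ?C * hs_pre_at s r A)"
  proof (rule Liminf_mono)
    show "\<forall>\<^sub>F r in at_right 0. hs_pre_at (s + t) (2 * r) (A \<times> B) \<le> ?C * hs_pre_at s r A"
      using B eventually_at_right_less[of 0]
    proof eventually_elim
      case (elim r)
      have "hs_pre_at (s + t) (2 * r) (A \<times> B)
          \<le> (covering_number r A * covering_number r B) * ennreal ((2 * (2 * r)) powr (s + t))"
        unfolding hs_pre_at_def by (intro mult_right_mono covering_number_Times_le) auto
      also have "(2 * (2 * r)) powr (s + t) = 2 powr (s + t) * (2 * r) powr s * (2 * r) powr t"
        using elim powr_mult[of 2 "2 * r" "s + t"] by (simp only: powr_add)
      also have "ennreal \<dots>
          = ennreal (2 powr (s + t)) * ennreal ((2 * r) powr s) * ennreal ((2 * r) powr t)"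
        by (simp add: ennreal_mult')
      also have "(covering_number r A * covering_number r B) * \<dots>
          = ennreal (2 powr (s + t)) * hs_pre_at t r B * hs_pre_at s r A"
        by (simp add: hs_pre_at_def mult_ac)
      also have "\<dots> \<le> ?C * hs_pre_at s r A"
        using elim by (intro mult_right_mono mult_left_mono) auto
      finally show ?case .
    qed
  qed
  also have "\<dots> = ?C * hs_pre s A"
    unfolding hs_pre_def using C by (intro Liminf_cmult_ennreal) auto
  also have "\<dots> < \<infinity>"
    using C A by (simp add: ennreal_mult_less_top)
  finally show ?thesis .
qed

section \<open>Pieces of uniformly positive density\<close>

text \<open>An \<open>r\<close>-separated set in \<open>E\<close> is the centre set of separated
  balls of radius \<open>r / 2\<close>, each of measure at least \<open>c * r powr t\<close>. The
  packing bound is then of order \<open>r powr (-t)\<close>, at every small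
  \<open>r\<close>.\<close>

lemma hs_pre_at_bounded_of_density:
  fixes B :: "'a::euclidean_space set"
  assumes m: "hs_measure t B < \<infinity>" and c: "c > 0" and h0: "h0 > 0"
    and E: "\<And>y h. \<lbrakk>y \<in> E; 0 < h; h < h0\<rbrakk> \<Longrightarrow> ennreal (c * (2 * h) powr t) \<le> hs_measure t (B \<inter> cball y h)"
  obtains K where "K < \<infinity>" "\<forall>\<^sub>F r in at_right 0. hs_pre_at t r E \<le> K"
proof -
  obtain m' where m': "hs_measure t B = ennreal m'" "m' \<ge> 0"
    using m by (cases "hs_measure t B") auto
  define K where "K = 2 powr t * (2 powr t * m') / c"
  \<comment> \<open>The density bound is used at \<open>h = r / 2\<close>, which has to stay below
    \<open>h0\<close>.\<close>
  have "\<forall>\<^sub>F r in at_right 0. r \<in> {0<..<2 * h0}"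
    using h0 by (intro eventually_at_rightI) auto
  then have "\<forall>\<^sub>F r in at_right 0. hs_pre_at t r E \<le> ennreal K"
  proof eventually_elim
    case (elim r)
    have "covering_number r E \<le> ennreal (2 powr t * m' / (c * r powr t))"
    proof (rule covering_number_le_packing)
      show "r \<ge> 0" using elim by simp
    next
      fix S assume S: "finite S" "S \<subseteq> E" "pairwise (\<lambda>x y. r < dist x y) S"
      have "real (card S) * (c * (2 * (r / 2)) powr t) \<le> 2 powr t * m'"
      proof (rule card_separated_mult_le[OF S(1) _ _ _ m'])
        fix y assume "y \<in> S"
        then show "ennreal (c * (2 * (r / 2)) powr t) \<le> hs_measure t (B \<inter> cball y (r / 2))"
          using S(2) elim by (intro E) auto
      qed (use S c in auto)
      then show "real (card S) \<le> 2 powr t * m' / (c * r powr t)"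
        using c elim by (simp add: pos_le_divide_eq)
    qed
    then have "hs_pre_at t r E \<le> ennreal (2 powr t * m' / (c * r powr t)) * ennreal ((2 * r) powr t)"
      unfolding hs_pre_at_def by (rule mult_right_mono) simp
    also have "\<dots> = ennreal K"
      using elim c m' by (simp add: K_def powr_mult field_simps flip: ennreal_mult')
    finally show ?case .
  qed
  then show ?thesis
    using that[of "ennreal K"] by simp
qed

text \<open>One index \<open>k\<close> bounds both the range of scales and the density, so that
  \<open>B\<close> splits into countably many uniform pieces.\<close>

lemma lower_density_posD:
  assumes "hs_lower_density t B y > 0"
  shows "\<exists>k::nat. \<forall>h. 0 < h \<longrightarrow> h < 1 / real (Suc k) \<longrightarrow>
    ennreal (1 / real (Suc k) * (2 * h) powr t) \<le> hs_measure t (B \<inter> cball y h)"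
proof -
  obtain c where c: "0 < c" "c < hs_lower_density t B y"
    using dense[OF assms] by auto
  then obtain c' where c': "c = ennreal c'" "c' > 0"
    by (cases c) auto
  have "\<forall>\<^sub>F h in at_right 0. c < hs_measure t (B \<inter> cball y h) / ennreal ((2 * h) powr t)"
    using c(2) unfolding hs_lower_density_def by (rule less_LiminfD)
  then obtain b where b: "b > 0"
      "\<And>h. \<lbrakk>0 < h; h < b\<rbrakk> \<Longrightarrow> c < hs_measure t (B \<inter> cball y h) / ennreal ((2 * h) powr t)"
    by (auto simp: eventually_at_right_field)
  obtain k where k: "1 / real (Suc k) < min b c'"
    using reals_Archimedean[of "min b c'"] b(1) c' by (auto simp: inverse_eq_divide)
  have "ennreal (1 / real (Suc k) * (2 * h) powr t) \<le> hs_measure t (B \<inter> cball y h)"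
    if h: "0 < h" "h < 1 / real (Suc k)" for h
  proof -
    have "ennreal (1 / real (Suc k) * (2 * h) powr t) \<le> ennreal (c' * (2 * h) powr t)"
      using k by (intro ennreal_leI mult_right_mono) auto
    also have "\<dots> = c * ennreal ((2 * h) powr t)"
      using c' by (simp add: ennreal_mult')
    also have "\<dots> \<le> hs_measure t (B \<inter> cball y h) / ennreal ((2 * h) powr t) * ennreal ((2 * h) powr t)"
      using b(2)[of h] h k by (intro mult_right_mono) auto
    \<comment> \<open>The division cancels because \<open>(2 * h) powr t\<close> is positive and
      finite for \<open>h > 0\<close>.\<close>
    also have "\<dots> = hs_measure t (B \<inter> cball y h)"
      using h by (simp add: ennreal_divide_times mult_divide_eq_ennreal)
    finally show ?thesis .
  qed
  then show ?thesis by blast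
qed

section \<open>Dimension of the product\<close>

text \<open>\<open>A\<close> is covered by sets \<open>F i\<close> of finite premeasure and
  \<open>B\<close> by its uniform pieces \<open>G k\<close>. Each product has finite premeasure in
  dimension \<open>s + t\<close>, hence premeasure zero in any larger dimension.\<close>

lemma hs_measure_Times_eq_0:
  fixes A :: "'a::euclidean_space set" and B :: "'b::euclidean_space set"
  assumes A: "hs_measure s A < \<infinity>" and B: "hs_measure t B < \<infinity>"
    and dens: "\<And>y. y \<in> B \<Longrightarrow> hs_lower_density t B y > 0"
    and u: "s + t < u"
  shows "hs_measure u (A \<times> B) = 0"
proof -
  obtain F :: "nat \<Rightarrow> 'a set" where F: "A \<subseteq> (\<Union>i. F i)" "(\<Sum>i. hs_pre s (F i)) < \<infinity>"
    using A unfolding hs_measure_def INF_less_iff by auto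
  define G where "G k = {y \<in> B. \<forall>h. 0 < h \<longrightarrow> h < 1 / real (Suc k) \<longrightarrow>
    ennreal (1 / real (Suc k) * (2 * h) powr t) \<le> hs_measure t (B \<inter> cball y h)}" for k
  have G: "B \<subseteq> (\<Union>k. G k)"
    using lower_density_posD[OF dens] by (fastforce simp: G_def)
  have zero: "hs_pre u (F i \<times> G k) = 0" for i k
  proof -
    obtain K where K: "K < \<infinity>" "\<forall>\<^sub>F r in at_right 0. hs_pre_at t r (G k) \<le> K"
    proof (rule hs_pre_at_bounded_of_density[OF B])
      show "ennreal (1 / real (Suc k) * (2 * h) powr t) \<le> hs_measure t (B \<inter> cball y h)"
        if "y \<in> G k" "0 < h" "h < 1 / real (Suc k)" for y h
        using that by (auto simp only: G_def)
    qed auto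
    have "hs_pre s (F i) < \<infinity>"
      using F(2) ennreal_suminf_lessD by simp
    then have "hs_pre (s + t) (F i \<times> G k) < \<infinity>"
      using K by (rule hs_pre_Times_finite)
    then show ?thesis
      using u by (rule hs_pre_eq_0)
  qed
  \<comment> \<open>The pairing function turns the doubly indexed cover into the sequence required
    by \<open>hs_measure\<close>.\<close>
  let ?H = "\<lambda>n. case prod_decode n of (i, k) \<Rightarrow> F i \<times> G k"
  have "A \<times> B \<subseteq> (\<Union>n. ?H n)"
  proof clarify
    fix x y assume "x \<in> A" "y \<in> B"
    then obtain i k where "x \<in> F i" "y \<in> G k" using F(1) G by blast
    then show "(x, y) \<in> (\<Union>n. ?H n)"
      by (intro UN_I[of "prod_encode (i, k)"]) auto
  qed
  then have "hs_measure u (A \<times> B) \<le> (\<Sum>n. hs_pre u (?H n))"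
    unfolding hs_measure_def by (intro INF_lower) auto
  also have "\<dots> = 0"
    by (simp add: zero case_prod_beta)
  finally show ?thesis by simp
qed

text \<open>In the description of the dimension as an infimum, an exponent \<open>a < s\<close> of
  measure zero would force measure zero at \<open>s\<close>.\<close>

lemma le_hs_dim:
  assumes "hs_measure s E > 0"
  shows "ennreal s \<le> hs_dim E"
  unfolding hs_dim_eq_INF
proof (rule INF_greatest, clarify)
  fix a :: real assume "hs_measure a E = 0"
  then have "\<not> a < s"
    using hs_measure_eq_0[of a E s] assms by auto
  then show "ennreal s \<le> ennreal a" by (simp add: ennreal_leI)
qed

theorem theorem4:
  fixes s t :: real and A B :: "real set"
  assumes "s \<ge> 0" and "t \<ge> 0"
    and "0 < hs_measure s A" and "hs_measure s A < \<infinity>"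
    and "0 < hs_measure t B" and "hs_measure t B < \<infinity>"
    and "hs_dim (A \<times> B) \<ge> hs_dim A + hs_dim B"
    and "\<And>y. y \<in> B \<Longrightarrow> hs_lower_density t B y > 0"
  shows "hs_dim (A \<times> B) = hs_dim A + hs_dim B"
proof (rule antisym)
  have "hs_dim (A \<times> B) \<le> ennreal (s + t)"
  \<comment> \<open>The measure of the product is known to vanish only strictly above
    \<open>s + t\<close>, so the bound is reached by letting \<open>e\<close> tend to 0.\<close>
  proof (rule ennreal_le_epsilon)
    fix e :: real assume "e > 0"
    then have "hs_measure (s + t + e) (A \<times> B) = 0"
      using assms by (intro hs_measure_Times_eq_0[of s A t B]) auto
    then have "hs_dim (A \<times> B) \<le> ennreal (s + t + e)"
      unfolding hs_dim_eq_INF using assms(1,2) \<open>e > 0\<close> by (intro INF_lower) auto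
    then show "hs_dim (A \<times> B) \<le> ennreal (s + t) + ennreal e"
      using assms(1,2) \<open>e > 0\<close> by (simp flip: ennreal_plus)
  qed
  also have "\<dots> = ennreal s + ennreal t"
    using assms(1,2) by simp
  \<comment> \<open>Positivity of the two measures enters here, bounding the dimensions below by
    \<open>s\<close> and \<open>t\<close>.\<close>
  also have "\<dots> \<le> hs_dim A + hs_dim B"
    using assms(3,5) by (intro add_mono le_hs_dim)
  finally show "hs_dim (A \<times> B) \<le> hs_dim A + hs_dim B" .
qed (fact assms(7))

end
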